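(* Let $T$ be a nontrivial finite metric tree of length $L=|T|$ and diameter $D$, let $r>0$, let $\Lambda_{T,r}=\frac{L}{r}U[0,r]$, and let $\nu$ be a probability measure on $\mathcal C(T)$ such that $E_\nu\le\Lambda_{T,r}$. Put $\Delta=\Lambda_{T,r}-E_\nu$ (a positive measure). Then $$0\le\int_0^r s\,d\Delta(s)\le\frac{L-D}{2},$$ and, for every $t\in(0,r]$, $$\Delta([t,r])\le\frac{L-D}{2t}.$$ Moreover, fix a diameter path $P$ in $T$ (an arc $T[a,b]$ with $d_T(a,b)=D$), and for every $m\ge1$ fix a Borel map $\mathbf v_m:\mathcal C_m(T)\cap[0,r]^m\to T^m$ selecting realizing centers. For a cover $(r_1,\dots,r_m)$ sampled from $\nu$ (whose radii lie in $[0,r]$ almost surely), with selected centers $(v_1,\dots,v_m)=\mathbf v_m(r_1,\dots,r_m)$, put $J_i=B_T(v_i,r_i)\cap P$. Then $A=\sum_i(2r_i-|J_i|)\ge0$ and $O=\sum_i|J_i|-D\ge0$, and $$\mathbb E_\nu[A+O]=L-D-2\int_0^r s\,d\Delta(s)\le L-D.$$ Consequently, for every $u>0$, $$\nu\bigl(A+O\ge u\bigr)\le\frac{L-D}{u}.$$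
   Context: A finite metric tree is the metric realization of a finite combinatorial tree whose edges have positive lengths; it is nontrivial if it is not a single point. $|T|$ is the total edge length, $d_T$ the path metric, $B_T(v,s)=\{x\in T: d_T(x,v)\le s\}$, and the diameter is $\max_{x,y\in T}d_T(x,y)$. $T[a,b]$ is the unique arc joining $a$ and $b$. For $m\ge1$, a tuple $\mathbf r=(r_1,\dots,r_m)\in\mathbb R_{\ge0}^m$ is a cover of $T$ if there are $v_1,\dots,v_m\in T$ with $T\subseteq\bigcup_i B_T(v_i,r_i)$; $\mathcal C_m(T)$ is the (closed) set of such tuples and $\mathcal C(T)=\bigsqcup_{m\ge1}\mathcal C_m(T)$ with the disjoint-union Borel structure. For a finite Borel measure $\nu$ on $\mathcal C(T)$, $E_\nu(A)=\int|\{i:r_i\in A\}|\,d\nu(\mathbf r)$ for Borel $A\subseteq\mathbb R_{\ge0}$. For positive Borel measures, $\mu\le\mu'$ means $\mu(A)\le\mu'(A)$ for all Borel $A$. $U[0,r]$ is the uniform probability measure on $[0,r]$, viewed as a measure on $\mathbb R_{\ge0}$. That $\mathbf v_m$ selects realizing centers means $T\subseteq\bigcup_i B_T(v_i,r_i)$ whenever $(v_1,\dots,v_m)=\mathbf v_m(r_1,\dots,r_m)$; such Borel maps exist by a measurable selection theorem. $|J_i|$ is the length (length measure along $P$) of $J_i$, which is $0$ if $J_i$ is empty. $\mathbb E_\nu$ is expectation under $\nu$. *)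

theory Defs
  imports "HOL-Probability.Probability"
begin

section \<open>Finite metric trees\<close>

text \<open>
  A combinatorial tree is a connected undirected graph without cycles. Every edge is listed in
  \<open>E\<close> exactly once, with an arbitrary orientation, so that it can be parametrized later; adjacency
  is membership in \<open>E \<union> E\<inverse>\<close>.
\<close>

definition combinatorial_tree :: "'v set \<Rightarrow> ('v \<times> 'v) set \<Rightarrow> bool" where
  "combinatorial_tree V E \<longleftrightarrow>
     finite V \<and> V \<noteq> {} \<and> E \<subseteq> V \<times> V \<and> asym E \<and>
     (\<forall>u\<in>V. \<forall>v\<in>V. (u, v) \<in> (E \<union> E\<inverse>)\<^sup>*) \<and>
     \<not> (\<exists>vs. 3 \<le> length vs \<and> distinct vs \<and>
            (\<forall>i<length vs. (vs ! i, vs ! (Suc i mod length vs)) \<in> E \<union> E\<inverse>))"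

text \<open>
  \<open>\<phi> e\<close> parametrizes the closed edge \<open>e\<close> by the interval \<open>{0..l e}\<close>.
  \<open>edge_chain T E l \<phi> x c y\<close>: one can move from \<open>x\<close> to \<open>y\<close> in finitely many steps, each of them
  inside one closed edge, with total travelled length \<open>c\<close>.
\<close>

inductive edge_chain ::
  "'a set \<Rightarrow> 'e set \<Rightarrow> ('e \<Rightarrow> real) \<Rightarrow> ('e \<Rightarrow> real \<Rightarrow> 'a) \<Rightarrow> 'a \<Rightarrow> real \<Rightarrow> 'a \<Rightarrow> bool"
  for T E l \<phi> where
  refl: "x \<in> T \<Longrightarrow> edge_chain T E l \<phi> x 0 x"
| step: "edge_chain T E l \<phi> x c (\<phi> e s) \<Longrightarrow> e \<in> E \<Longrightarrow> s \<in> {0..l e} \<Longrightarrow> t \<in> {0..l e} \<Longrightarrow>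
         edge_chain T E l \<phi> x (c + \<bar>s - t\<bar>) (\<phi> e t)"

text \<open>
  The set \<open>T\<close> with the metric of the ambient type is the metric realization of the combinatorial
  tree \<open>(V, E)\<close> with edge lengths \<open>l\<close>: the vertices are points of \<open>T\<close>, an interval of length \<open>l e\<close>
  is glued in for each edge \<open>e\<close>, no identifications are made other than those at the vertices, and
  the metric is the path metric.
\<close>

definition metric_tree ::
  "'a::metric_space set \<Rightarrow> 'a set \<Rightarrow> ('a \<times> 'a) set \<Rightarrow> ('a \<times> 'a \<Rightarrow> real) \<Rightarrow>
     ('a \<times> 'a \<Rightarrow> real \<Rightarrow> 'a) \<Rightarrow> bool" where
  "metric_tree T V E l \<phi> \<longleftrightarrow>
     combinatorial_tree V E \<and>
     (\<forall>e\<in>E. 0 < l e) \<and>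
     T = V \<union> (\<Union>e\<in>E. \<phi> e ` {0..l e}) \<and>
     (\<forall>(u, v)\<in>E. \<phi> (u, v) 0 = u \<and> \<phi> (u, v) (l (u, v)) = v) \<and>
     inj_on (\<lambda>(e, s). \<phi> e s) (SIGMA e:E. {0<..<l e}) \<and>
     (\<forall>e\<in>E. \<forall>s\<in>{0<..<l e}. \<phi> e s \<notin> V) \<and>
     (\<forall>x\<in>T. \<forall>y\<in>T. dist x y = Inf {c. edge_chain T E l \<phi> x c y})"

definition total_length :: "'e set \<Rightarrow> ('e \<Rightarrow> real) \<Rightarrow> real" where
  "total_length E l = (\<Sum>e\<in>E. l e)"

text \<open>
  The length measure of the tree, that is, Lebesgue measure on every edge. The length measure along
  an arc in the tree is its restriction to the subsets of that arc.
\<close>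

definition tree_length ::
  "'e set \<Rightarrow> ('e \<Rightarrow> real) \<Rightarrow> ('e \<Rightarrow> real \<Rightarrow> 'a) \<Rightarrow> 'a set \<Rightarrow> real" where
  "tree_length E l \<phi> A = (\<Sum>e\<in>E. measure lborel {s \<in> {0..l e}. \<phi> e s \<in> A})"

definition tree_ball :: "'a::metric_space set \<Rightarrow> 'a \<Rightarrow> real \<Rightarrow> 'a set" where
  "tree_ball T v s = {x \<in> T. dist x v \<le> s}"

definition arc_joining :: "'a::metric_space set \<Rightarrow> 'a \<Rightarrow> 'a \<Rightarrow> 'a set \<Rightarrow> bool" where
  "arc_joining T a b P \<longleftrightarrow>
     (\<exists>g. arc g \<and> path_image g \<subseteq> T \<and> pathstart g = a \<and> pathfinish g = b \<and> P = path_image g)"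

definition diameter_path :: "'a::metric_space set \<Rightarrow> 'a set \<Rightarrow> bool" where
  "diameter_path T P \<longleftrightarrow> (\<exists>a b. arc_joining T a b P \<and> dist a b = diameter T)"


section \<open>Covers\<close>

text \<open>
  The \<open>m\<close>-tuples are the extensional functions on \<open>{..<m}\<close>, and the Borel sets of a finite power
  are the product \<open>\<sigma>\<close>-algebra (all factors are second countable).
\<close>

abbreviation nonneg_borel :: "real measure" where
  "nonneg_borel \<equiv> restrict_space borel {0..}"

definition realizes_cover :: "'a::metric_space set \<Rightarrow> nat \<Rightarrow> (nat \<Rightarrow> 'a) \<Rightarrow> (nat \<Rightarrow> real) \<Rightarrow> bool" where
  "realizes_cover T m v \<rho> \<longleftrightarrow> T \<subseteq> (\<Union>i<m. tree_ball T (v i) (\<rho> i))"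

definition covers :: "'a::metric_space set \<Rightarrow> nat \<Rightarrow> (nat \<Rightarrow> real) set" where
  "covers T m =
     {\<rho> \<in> {..<m} \<rightarrow>\<^sub>E {0..}. \<exists>v \<in> {..<m} \<rightarrow>\<^sub>E T. realizes_cover T m v \<rho>}"

definition bounded_covers :: "'a::metric_space set \<Rightarrow> real \<Rightarrow> nat \<Rightarrow> (nat \<Rightarrow> real) set" where
  "bounded_covers T r m = covers T m \<inter> ({..<m} \<rightarrow>\<^sub>E {0..r})"

text \<open>The disjoint union of the spaces \<open>covers T m\<close>, \<open>m \<ge> 1\<close>, is a space of pairs \<open>(m, \<rho>)\<close>.\<close>

definition cover_space :: "'a::metric_space set \<Rightarrow> (nat \<times> (nat \<Rightarrow> real)) measure" where
  "cover_space T =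
     sigma (SIGMA m:{1..}. covers T m)
       {{m} \<times> A | m A. 1 \<le> m \<and>
          A \<in> sets (restrict_space (PiM {..<m} (\<lambda>_. nonneg_borel)) (covers T m))}"

definition radius_count :: "real set \<Rightarrow> nat \<times> (nat \<Rightarrow> real) \<Rightarrow> nat" where
  "radius_count A = (\<lambda>(m, \<rho>). card {i. i < m \<and> \<rho> i \<in> A})"

definition radius_measure :: "(nat \<times> (nat \<Rightarrow> real)) measure \<Rightarrow> real measure" where
  "radius_measure \<nu> =
     measure_of {0..} (sets nonneg_borel) (\<lambda>A. \<integral>\<^sup>+x. of_nat (radius_count A x) \<partial>\<nu>)"

text \<open>The set function in the definition of \<open>radius_measure\<close> is countably additive, so \<open>measure_of\<close> does not
  fall back to the zero measure.\<close>

lemma radius_count_meas: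
  assumes A: "A \<in> sets nonneg_borel" and s: "sets \<nu> = sets (cover_space T)"
  shows "(\<lambda>x. of_nat (radius_count A x) :: ennreal) \<in> borel_measurable \<nu>"
proof -
  let ?S = "SIGMA m:{1..}. covers T m"
  let ?G = "{{m} \<times> A | m A. 1 \<le> m \<and>
          A \<in> sets (restrict_space (PiM {..<m} (\<lambda>_. nonneg_borel)) (covers T m))}"
  have sp: "space (PiM {..<m} (\<lambda>_. nonneg_borel)) = {..<m} \<rightarrow>\<^sub>E {0..}" for m::nat
    by (simp add: space_PiM space_restrict_space)
  have cs: "covers T m \<subseteq> {..<m} \<rightarrow>\<^sub>E {0..}" for m by (auto simp: covers_def)
  have G: "?G \<subseteq> Pow ?S"
    using cs by (auto simp: sets_restrict_space dest!: sets.sets_into_space)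
  have sets: "sets \<nu> = sigma_sets ?S ?G" using s G unfolding cover_space_def by simp
  have space: "space \<nu> = ?S" using sets_eq_imp_space_eq[OF s] G unfolding cover_space_def by (simp add: space_measure_of)
  have g: "(\<lambda>x. radius_count A x) \<in> \<nu> \<rightarrow>\<^sub>M count_space UNIV"
  proof (rule measurableI)
    fix Y :: "nat set"
    have "radius_count A -` Y \<inter> space \<nu> = (\<Union>m\<in>{1..}. {m} \<times> {\<rho>\<in>covers T m. card {i. i<m \<and> \<rho> i \<in> A} \<in> Y})"
      by (auto simp: radius_count_def space)
    also have "\<dots> \<in> sets \<nu>"
    proof (rule sets.countable_UN'')
      fix m::nat assume m: "m \<in> {1..}"
      let ?M = "PiM {..<m} (\<lambda>_. nonneg_borel)"
      have "{\<rho>\<in>space ?M. card {i. i<m \<and> \<rho> i \<in> A} \<in> Y} \<in> sets ?M"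
      proof -
        have "(\<lambda>\<rho>. \<Sum>i<m. if \<rho> i \<in> A then 1 else 0 :: nat) \<in> ?M \<rightarrow>\<^sub>M count_space UNIV"
          using A by (intro measurable_sum_nat measurable_If measurable_const) (auto simp: pred_def intro!: measurable_sets_Collect measurable_component_singleton)
        moreover have "card {i. i<m \<and> \<rho> i \<in> A} = (\<Sum>i<m. if \<rho> i \<in> A then 1 else 0 :: nat)" for \<rho> :: "nat \<Rightarrow> real"
          by (simp add: sum.If_cases Int_def)
        ultimately show ?thesis by (auto simp: measurable_def Int_def vimage_def conj_commute)
      qed
      then have "covers T m \<inter> {\<rho>\<in>space ?M. card {i. i<m \<and> \<rho> i \<in> A} \<in> Y} \<in> sets (restrict_space ?M (covers T m))"
        unfolding sets_restrict_space by (rule imageI)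
      moreover have "covers T m \<inter> {\<rho>\<in>space ?M. card {i. i<m \<and> \<rho> i \<in> A} \<in> Y} = {\<rho>\<in>covers T m. card {i. i<m \<and> \<rho> i \<in> A} \<in> Y}"
        unfolding sp using cs[of m] by blast
      ultimately have "{\<rho>\<in>covers T m. card {i. i<m \<and> \<rho> i \<in> A} \<in> Y} \<in> sets (restrict_space ?M (covers T m))"
        by (simp only:)
      then show "{m} \<times> {\<rho>\<in>covers T m. card {i. i<m \<and> \<rho> i \<in> A} \<in> Y} \<in> sets \<nu>"
        unfolding sets using m by (intro sigma_sets.Basic) blast
    qed auto
    finally show "radius_count A -` Y \<inter> space \<nu> \<in> sets \<nu>" .
  qed auto
  show ?thesis by (rule measurable_compose[OF g]) simp
qed

lemma emeasure_radius_measure: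
  assumes A: "A \<in> sets nonneg_borel" and s: "sets \<nu> = sets (cover_space T)"
  shows "emeasure (radius_measure \<nu>) A = (\<integral>\<^sup>+x. of_nat (radius_count A x) \<partial>\<nu>)"
proof -
  let ?f = "\<lambda>A. \<integral>\<^sup>+x. of_nat (radius_count A x) \<partial>\<nu>"
  have sp: "space nonneg_borel = {0..}" by (simp add: space_restrict_space)
  have ca: "countably_additive (sets nonneg_borel) ?f"
  proof (rule countably_additiveI)
    fix B :: "nat \<Rightarrow> real set" assume B: "range B \<subseteq> sets nonneg_borel" "disjoint_family B"
    have "(\<Sum>i. ?f (B i)) = (\<integral>\<^sup>+x. (\<Sum>i. of_nat (radius_count (B i) x)) \<partial>\<nu>)"
      using B s by (intro nn_integral_suminf[symmetric] radius_count_meas) auto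
    also have "\<dots> = ?f (\<Union>i. B i)"
    proof (rule nn_integral_cong)
      fix x :: "nat \<times> (nat \<Rightarrow> real)"
      obtain m \<rho> where x: "x = (m,\<rho>)" by force
      have c: "of_nat (radius_count Y x) = (\<Sum>i<m. indicator Y (\<rho> i) :: ennreal)" for Y
        by (simp add: x radius_count_def indicator_def sum.If_cases Int_def)
      have "(\<Sum>j. \<Sum>i<m. indicator (B j) (\<rho> i) :: ennreal) = (\<Sum>i<m. \<Sum>j. indicator (B j) (\<rho> i))"
        by (rule suminf_sum) auto
      also have "\<dots> = (\<Sum>i<m. indicator (\<Union>j. B j) (\<rho> i))"
        by (simp add: suminf_indicator[OF B(2)])
      finally show "(\<Sum>i. of_nat (radius_count (B i) x)) = (of_nat (radius_count (\<Union>i. B i) x)::ennreal)"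
        by (simp only: c)
    qed
    finally show "(\<Sum>i. ?f (B i)) = ?f (\<Union>i. B i)" .
  qed
  have "positive (sets nonneg_borel) ?f" by (simp add: positive_def radius_count_def case_prod_beta)
  with ca show ?thesis unfolding radius_measure_def
    using A sp sets.sigma_algebra_axioms[of nonneg_borel] by (intro emeasure_measure_of_sigma) auto
qed
definition scaled_uniform :: "real \<Rightarrow> real \<Rightarrow> real measure" where
  "scaled_uniform L r =
     scale_measure (ennreal (L / r)) (uniform_measure (restrict_space lborel {0..}) {0..r})"

definition selects_centers ::
  "'a::metric_space set \<Rightarrow> real \<Rightarrow> nat \<Rightarrow> ((nat \<Rightarrow> real) \<Rightarrow> (nat \<Rightarrow> 'a)) \<Rightarrow> bool" where
  "selects_centers T r m f \<longleftrightarrow>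
     f \<in> restrict_space (PiM {..<m} (\<lambda>_. nonneg_borel)) (bounded_covers T r m)
           \<rightarrow>\<^sub>M PiM {..<m} (\<lambda>_. restrict_space borel T) \<and>
     (\<forall>\<rho>\<in>bounded_covers T r m. realizes_cover T m (f \<rho>) \<rho>)"

text \<open>
  The length of \<open>J\<^sub>i\<close>, and the quantities \<open>A\<close> and \<open>O\<close>, as functions of the cover \<open>(m, \<rho>)\<close>.
\<close>

definition trace_length where
  "trace_length T E l \<phi> P vm m \<rho> i =
     tree_length E l \<phi> (tree_ball T (vm m \<rho> i) (\<rho> i) \<inter> P)"

definition cover_waste where
  "cover_waste T E l \<phi> P vm =
     (\<lambda>(m::nat, \<rho>::nat \<Rightarrow> real). \<Sum>i<m. 2 * \<rho> i - trace_length T E l \<phi> P vm m \<rho> i)"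

definition cover_overlap where
  "cover_overlap T E l \<phi> P vm =
     (\<lambda>(m::nat, \<rho>::nat \<Rightarrow> real). (\<Sum>i<m. trace_length T E l \<phi> P vm m \<rho> i) - diameter T)"

end

theory Submission
  imports Defs
begin

text \<open>
  The waste and the overlap of a cover telescope: the trace lengths cancel in their sum, and
  \<open>A + O = 2 (\<Sum>i. r\<^sub>i) - D\<close>. The probabilistic part is therefore a first moment
  computation. Since \<open>\<Delta> + E\<^sub>\<nu> = \<Lambda>\<close>, and \<open>\<Lambda>\<close> has first moment \<open>L / 2\<close>, the expected sum of
  the radii is \<open>L / 2 - \<integral> s d\<Delta>\<close> (\<open>moment_balance\<close>). The upper bound on the first moment of
  \<open>\<Delta>\<close> is then the fact that a cover by balls satisfies \<open>D \<le> 2 (\<Sum>i. r\<^sub>i)\<close>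
  (\<open>diameter_le_sum_radii\<close>), and both tail bounds are instances of Markov's inequality.

  The geometric part is that \<open>A\<close> and \<open>O\<close> are separately nonnegative. Here the tree structure is
  used through one coordinate for every edge, the projection of the tree to that edge, which is well
  defined because an edge of a tree separates its ends. Moving inside one edge changes only the
  coordinate of that edge, so the sum over all edges of the coordinate differences of two points is at
  most their distance. An arc cannot turn back inside an edge, because it would have to pass the same
  point twice; so along an arc every coordinate stays between its values at the ends
  (\<open>edge_coord_between_on_arc\<close>). Hence the part of an arc between its first and its last
  point in a ball is no longer than the distance of these two points, which is at most twice the
  radius (\<open>length_trace_le\<close>). Conversely, the coordinate differences of the two ends of an
  arc add up to at least their distance (\<open>dist_le_sum_edge_coord_on_arc\<close>), and the traces of a
  cover exhaust these differences by the intermediate value theorem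
  (\<open>sum_edge_coord_le_sum_traces\<close>).
\<close>

section \<open>Lengths in an interval\<close>

text \<open>
  The finite set \<open>N\<close> leaves room for the images of the vertices, which carry no length.
\<close>

lemma length_le_sum_of_covering_balls:
  fixes D :: real and c \<rho> :: "'i \<Rightarrow> real"
  assumes "finite N" "finite I"
    and \<rho>: "\<And>i. i \<in> I \<Longrightarrow> 0 \<le> \<rho> i"
    and cover: "{0..D} \<subseteq> N \<union> (\<Union>i\<in>I. {c i - \<rho> i..c i + \<rho> i})"
  shows "D \<le> (\<Sum>i\<in>I. 2 * \<rho> i)"
proof (cases "0 \<le> D")
  case True
  let ?B = "\<lambda>i. {c i - \<rho> i..c i + \<rho> i}"
  have N: "N \<in> sets borel"
    using assms(1) by (intro borel_closed finite_imp_closed)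
  have "ennreal D = emeasure lborel {0..D}"
    using True by simp
  also have "\<dots> \<le> emeasure lborel (N \<union> (\<Union>i\<in>I. ?B i))"
    using assms(2) N by (intro emeasure_mono cover) (auto intro!: sets.finite_UN)
  also have "\<dots> \<le> emeasure lborel N + emeasure lborel (\<Union>i\<in>I. ?B i)"
    using assms(2) N by (intro emeasure_subadditive) (auto intro!: sets.finite_UN)
  also have "emeasure lborel N = 0"
    using assms(1) by (intro emeasure_lborel_countable countable_finite)
  also have "0 + emeasure lborel (\<Union>i\<in>I. ?B i) \<le> (\<Sum>i\<in>I. emeasure lborel (?B i))"
    using assms(2) by (simp, intro emeasure_subadditive_finite) auto
  also have "\<dots> = (\<Sum>i\<in>I. ennreal (2 * \<rho> i))"
    using \<rho> by (intro sum.cong) auto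
  also have "\<dots> = ennreal (\<Sum>i\<in>I. 2 * \<rho> i)"
    using \<rho> by (intro sum_ennreal) auto
  finally show ?thesis
    using \<rho> by (subst (asm) ennreal_le_iff) (auto intro!: sum_nonneg)
qed (use \<rho> sum_nonneg[of I "\<lambda>i. 2 * \<rho> i"] in force)

text \<open>
  If \<open>k\<close> exceeded both end values at an inner point, it would take some value just below the
  peak twice, once on the way up and once on the way down. The two extreme values \<open>lo\<close> and
  \<open>hi\<close> may be repeated, because they are the values of an edge coordinate off its edge.
\<close>

lemma no_peak_if_interior_values_simple:
  fixes k :: "real \<Rightarrow> real"
  assumes cont: "continuous_on {0..1} k"
    and range: "\<And>s. s \<in> {0..1} \<Longrightarrow> k s \<in> {lo..hi}"
    and simple: "\<And>s t. s \<in> {0..1} \<Longrightarrow> t \<in> {0..1} \<Longrightarrow> k s = k t \<Longrightarrow> k s \<in> {lo<..<hi} \<Longrightarrow> s = t"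
    and order: "0 \<le> p" "p \<le> q" "q \<le> s" "s \<le> 1"
  shows "k q \<le> max (k p) (k s)"
proof (rule ccontr)
  assume "\<not> ?thesis"
  then obtain c where c: "k p < c" "k s < c" "c < k q"
    by (metis dense max_less_iff_conj not_le)
  have "\<exists>x\<ge>p. x \<le> q \<and> k x = c"
    using c order by (intro IVT' continuous_on_subset[OF cont]) auto
  then obtain x where x: "p \<le> x" "x \<le> q" "k x = c" by blast
  have "\<exists>y\<ge>q. y \<le> s \<and> k y = c"
    using c order by (intro IVT2' continuous_on_subset[OF cont]) auto
  then obtain y where y: "q \<le> y" "y \<le> s" "k y = c" by blast
  have "c \<in> {lo<..<hi}"
    using c range[of p] range[of q] order by auto
  then have "x = y"
    using simple[of x y] x y order by auto
  then show False
    using x y c by auto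
qed

lemma between_if_interior_values_simple:
  fixes k :: "real \<Rightarrow> real"
  assumes cont: "continuous_on {0..1} k"
    and range: "\<And>s. s \<in> {0..1} \<Longrightarrow> k s \<in> {lo..hi}"
    and simple: "\<And>s t. s \<in> {0..1} \<Longrightarrow> t \<in> {0..1} \<Longrightarrow> k s = k t \<Longrightarrow> k s \<in> {lo<..<hi} \<Longrightarrow> s = t"
    and order: "0 \<le> p" "p \<le> q" "q \<le> s" "s \<le> 1"
  shows "k q \<in> {min (k p) (k s)..max (k p) (k s)}"
proof -
  have "k q \<le> max (k p) (k s)"
    by (rule no_peak_if_interior_values_simple[OF cont range simple order])
  moreover have "- k q \<le> max (- k p) (- k s)"
    by (rule no_peak_if_interior_values_simple[where k = "\<lambda>s. - k s" and lo = "-hi" and hi = "-lo"])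
      (use range simple order in \<open>auto intro!: continuous_intros cont\<close>)
  ultimately show ?thesis by auto
qed

section \<open>Paths in a combinatorial tree\<close>

lemma rtrancl_distinct_path:
  assumes "(x, y) \<in> R\<^sup>*"
  shows "\<exists>vs. vs \<noteq> [] \<and> hd vs = x \<and> last vs = y \<and> distinct vs \<and>
    (\<forall>i. Suc i < length vs \<longrightarrow> (vs ! i, vs ! Suc i) \<in> R)"
  using assms
proof (induction rule: rtrancl_induct)
  case base
  show ?case by (intro exI[of _ "[x]"]) auto
next
  case (step y z)
  then obtain vs where vs: "vs \<noteq> []" "hd vs = x" "last vs = y" "distinct vs"
    "\<And>i. Suc i < length vs \<Longrightarrow> (vs ! i, vs ! Suc i) \<in> R" by blast
  show ?case
  proof (cases "z \<in> set vs")
    \<comment> \<open>A path that already visited \<open>z\<close> is cut off there.\<close>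
    case True
    then obtain i where i: "i < length vs" "vs ! i = z" by (auto simp: in_set_conv_nth)
    then show ?thesis
      using vs by (intro exI[of _ "take (Suc i) vs"]) (auto simp: last_conv_nth)
  next
    case False
    have "(vs ! i, (vs @ [z]) ! Suc i) \<in> R" if "i < length vs" for i
      using that vs step.hyps(2)
      by (cases "Suc i = length vs") (auto simp: nth_append last_conv_nth dest: arg_cong[where f = "\<lambda>n. n - 1"])
    then show ?thesis
      using vs False by (intro exI[of _ "vs @ [z]"]) (auto simp: nth_append)
  qed
qed

text \<open>
  The vertices on the side of the first end of \<open>e\<close> once the edge \<open>e\<close> is removed.
\<close>

definition edge_side :: "('v \<times> 'v) set \<Rightarrow> 'v \<times> 'v \<Rightarrow> 'v set" where
  "edge_side E e = {w. (fst e, w) \<in> (E \<union> E\<inverse> - {e, (snd e, fst e)})\<^sup>*}"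

text \<open>
  This is where acyclicity enters: a path around \<open>e\<close> joining its ends would close up with \<open>e\<close>
  to a cycle. It has at least three vertices because the step along \<open>e\<close> itself is excluded.
\<close>

lemma snd_notin_edge_side:
  assumes tree: "combinatorial_tree V E" and e: "e \<in> E"
  shows "snd e \<notin> edge_side E e"
proof
  let ?R = "E \<union> E\<inverse> - {e, (snd e, fst e)}"
  assume "snd e \<in> edge_side E e"
  then obtain vs where vs: "vs \<noteq> []" "hd vs = fst e" "last vs = snd e" "distinct vs"
    "\<And>i. Suc i < length vs \<Longrightarrow> (vs ! i, vs ! Suc i) \<in> ?R"
    using rtrancl_distinct_path[of "fst e" "snd e" ?R] by (auto simp: edge_side_def)
  have "asym E" using tree by (simp add: combinatorial_tree_def)
  then have ne: "fst e \<noteq> snd e"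
    using e by (metis asymD prod.collapse)
  have "length vs \<noteq> 1"
    using vs ne by (auto simp: length_Suc_conv)
  moreover have "length vs \<noteq> 2"
  proof
    assume "length vs = 2"
    then have "(fst e, snd e) \<in> ?R"
      using vs by (auto simp: hd_conv_nth last_conv_nth)
    then show False by simp
  qed
  ultimately have len: "3 \<le> length vs"
    using vs(1) by (cases vs rule: list.exhaust) (auto simp: numeral_eq_Suc Suc_le_eq neq_Nil_conv intro!: gr0I)
  have "(vs ! i, vs ! (Suc i mod length vs)) \<in> E \<union> E\<inverse>" if "i < length vs" for i
  proof (cases "Suc i = length vs")
    case True
    then have "i = length vs - 1" by simp
    with True have "vs ! i = snd e" "vs ! (Suc i mod length vs) = fst e"
      using vs by (simp_all add: hd_conv_nth last_conv_nth)
    then show ?thesis using e by simp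
  qed (use that vs in auto)
  then show False
    using tree len vs(4) unfolding combinatorial_tree_def by blast
qed

text \<open>
  Removing \<open>e\<close> leaves every other edge in place: the pair \<open>(snd e, fst e)\<close>, which is removed as
  well, is not in \<open>E\<close>, since \<open>E\<close> lists each edge in one orientation only.
\<close>

lemma edge_side_other_edge:
  assumes "combinatorial_tree V E" "e \<in> E" "e' \<in> E" "e' \<noteq> e"
  shows "fst e' \<in> edge_side E e \<longleftrightarrow> snd e' \<in> edge_side E e"
proof -
  let ?R = "E \<union> E\<inverse> - {e, (snd e, fst e)}"
  have "asym E" using assms(1) by (simp add: combinatorial_tree_def)
  then have "(snd e, fst e) \<notin> E"
    using assms(2) by (metis asymD prod.collapse)
  then have "(fst e', snd e') \<in> ?R" "(snd e', fst e') \<in> ?R"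
    using assms(2-4) by (cases e; cases e'; auto)+
  then show ?thesis
    unfolding edge_side_def by (auto intro: rtrancl_into_rtrancl)
qed

section \<open>Edge coordinates\<close>

locale realized_tree =
  fixes T V :: "'a::metric_space set" and E :: "('a \<times> 'a) set"
    and l :: "'a \<times> 'a \<Rightarrow> real" and \<phi> :: "'a \<times> 'a \<Rightarrow> real \<Rightarrow> 'a"
  assumes tree: "metric_tree T V E l \<phi>"
begin

lemma comb: "combinatorial_tree V E"
  and edge_pos: "e \<in> E \<Longrightarrow> 0 < l e"
  and T_eq: "T = V \<union> (\<Union>e\<in>E. \<phi> e ` {0..l e})"
  and dist_eq: "x \<in> T \<Longrightarrow> y \<in> T \<Longrightarrow> dist x y = Inf {c. edge_chain T E l \<phi> x c y}"
  and edge_interior_notin_V: "e \<in> E \<Longrightarrow> s \<in> {0<..<l e} \<Longrightarrow> \<phi> e s \<notin> V"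
  using tree by (auto simp: metric_tree_def)

lemma edge_start: "e \<in> E \<Longrightarrow> \<phi> e 0 = fst e"
  and edge_end: "e \<in> E \<Longrightarrow> \<phi> e (l e) = snd e"
  using tree by (cases e; auto simp: metric_tree_def)+

lemma finite_V: "finite V" and V_nonempty: "V \<noteq> {}"
  using comb by (auto simp: combinatorial_tree_def)

lemma finite_E: "finite E"
  using comb by (auto simp: combinatorial_tree_def intro: finite_subset)

lemma edges_in_V: "E \<subseteq> V \<times> V"
  using comb by (auto simp: combinatorial_tree_def)

lemma edge_vertices: "e \<in> E \<Longrightarrow> fst e \<in> V" "e \<in> E \<Longrightarrow> snd e \<in> V"
  using comb by (auto simp: combinatorial_tree_def)

lemma edge_in_T: "e \<in> E \<Longrightarrow> s \<in> {0..l e} \<Longrightarrow> \<phi> e s \<in> T"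
  using T_eq by blast

lemma edge_interior_unique:
  assumes "e \<in> E" "s \<in> {0<..<l e}" "e' \<in> E" "t \<in> {0..l e'}" "\<phi> e s = \<phi> e' t"
  shows "e' = e" "t = s"
proof -
  have "\<phi> e' t \<notin> V" using edge_interior_notin_V assms by metis
  then have "t \<noteq> 0" "t \<noteq> l e'"
    using edge_start edge_end edge_vertices assms(3) by metis+
  then have t: "t \<in> {0<..<l e'}" using assms(4) by auto
  have "inj_on (\<lambda>(e, s). \<phi> e s) (SIGMA e:E. {0<..<l e})"
    using tree by (simp add: metric_tree_def)
  from inj_onD[OF this, of "(e, s)" "(e', t)"] show "e' = e" "t = s"
    using assms t by auto
qed

text \<open>
  The coordinate along \<open>e\<close>: the projection of the tree to the edge \<open>e\<close>, collapsing the two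
  components of the complement of the open edge to its ends.
\<close>

definition edge_coord :: "'a \<times> 'a \<Rightarrow> 'a \<Rightarrow> real" where
  "edge_coord e x =
     (if \<exists>s\<in>{0<..<l e}. \<phi> e s = x then SOME s. s \<in> {0<..<l e} \<and> \<phi> e s = x
      else if x \<in> edge_side E e \<union> (\<Union>e'\<in>{e'\<in>E - {e}. fst e' \<in> edge_side E e}. \<phi> e' ` {0..l e'})
      then 0 else l e)"

lemma edge_coord_interior:
  assumes "e \<in> E" "s \<in> {0<..<l e}"
  shows "edge_coord e (\<phi> e s) = s"
proof -
  have "(SOME s'. s' \<in> {0<..<l e} \<and> \<phi> e s' = \<phi> e s) = s"
    using assms edge_interior_unique(2)[OF assms, of e] by (intro some_equality) auto
  then show ?thesis using assms unfolding edge_coord_def by auto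
qed

lemma edge_coord_vertex:
  assumes "e \<in> E" "w \<in> V"
  shows "edge_coord e w = (if w \<in> edge_side E e then 0 else l e)"
proof -
  have "w \<in> edge_side E e"
    if e': "e' \<in> E" "e' \<noteq> e" "fst e' \<in> edge_side E e" and s: "s \<in> {0..l e'}" "\<phi> e' s = w" for e' s
  proof -
    have "s = 0 \<or> s = l e'"
      using edge_interior_notin_V[OF e'(1), of s] s assms(2) by force
    then show ?thesis
      using s e' edge_start[OF e'(1)] edge_end[OF e'(1)] edge_side_other_edge[OF comb assms(1) e'(1,2)]
      by auto
  qed
  then have "w \<in> edge_side E e \<union> (\<Union>e'\<in>{e'\<in>E - {e}. fst e' \<in> edge_side E e}. \<phi> e' ` {0..l e'})
      \<longleftrightarrow> w \<in> edge_side E e" by blast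
  moreover have "\<not> (\<exists>s\<in>{0<..<l e}. \<phi> e s = w)"
    using edge_interior_notin_V assms by blast
  ultimately show ?thesis by (simp only: edge_coord_def if_False)
qed

lemma edge_coord_own_edge:
  assumes "e \<in> E" "s \<in> {0..l e}"
  shows "edge_coord e (\<phi> e s) = s"
proof -
  have "edge_coord e (fst e) = 0"
    using assms(1) edge_vertices by (simp add: edge_coord_vertex edge_side_def)
  moreover have "edge_coord e (snd e) = l e"
    using assms(1) edge_vertices snd_notin_edge_side[OF comb] by (simp add: edge_coord_vertex)
  moreover have "s = 0 \<or> s = l e \<or> s \<in> {0<..<l e}" using assms(2) by auto
  ultimately show ?thesis
    using edge_start[OF assms(1)] edge_end[OF assms(1)] edge_coord_interior[OF assms(1)] by metis
qed

lemma edge_coord_other_edge: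
  assumes e: "e \<in> E" and e': "e' \<in> E" "e' \<noteq> e" and s: "s \<in> {0..l e'}"
  shows "edge_coord e (\<phi> e' s) = edge_coord e (fst e')"
proof -
  consider "s = 0" | "s = l e'" | "s \<in> {0<..<l e'}" using s by fastforce
  then show ?thesis
  proof cases
    case 1
    then show ?thesis using edge_start[OF e'(1)] by simp
  next
    case 2
    then show ?thesis
      using edge_end[OF e'(1)] edge_side_other_edge[OF comb e e']
      by (simp add: edge_coord_vertex e e' edge_vertices)
  next
    case 3
    have "\<not> (\<exists>t\<in>{0<..<l e}. \<phi> e t = \<phi> e' s)"
      using edge_interior_unique(1)[OF e _ e'(1) s] e'(2) by blast
    moreover have "\<phi> e' s \<in> edge_side E e \<union> (\<Union>e''\<in>{e''\<in>E - {e}. fst e'' \<in> edge_side E e}. \<phi> e'' ` {0..l e''})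
        \<longleftrightarrow> fst e' \<in> edge_side E e" (is "?L \<longleftrightarrow> ?R")
    proof
      assume ?R
      then show ?L using e' s by blast
    next
      have "edge_side E e \<subseteq> V"
      proof
        fix w assume "w \<in> edge_side E e"
        then have "(fst e, w) \<in> (E \<union> E\<inverse> - {e, (snd e, fst e)})\<^sup>*" by (simp add: edge_side_def)
        then show "w \<in> V"
          by (induction rule: rtrancl_induct) (use edge_vertices(1)[OF e] edges_in_V in auto)
      qed
      then have "\<phi> e' s \<notin> edge_side E e" using edge_interior_notin_V[OF e'(1) 3] by blast
      moreover assume ?L
      ultimately obtain e'' t where "e'' \<in> E" "fst e'' \<in> edge_side E e" "t \<in> {0..l e''}" "\<phi> e' s = \<phi> e'' t"
        by blast
      then show ?R using edge_interior_unique(1)[OF e'(1) 3] by metis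
    qed
    ultimately show ?thesis
      unfolding edge_coord_vertex[OF e edge_vertices(1)[OF e'(1)]] by (simp only: edge_coord_def if_False)
  qed
qed

lemma edge_coord_cases:
  assumes "e \<in> E"
  shows "edge_coord e x = 0 \<or> edge_coord e x = l e \<or> edge_coord e x \<in> {0<..<l e} \<and> x = \<phi> e (edge_coord e x)"
proof (cases "\<exists>s\<in>{0<..<l e}. \<phi> e s = x")
  case True
  then obtain s where s: "s \<in> {0<..<l e}" "x = \<phi> e s" by blast
  then have "edge_coord e x = s" using edge_coord_interior[OF assms] by simp
  then show ?thesis using s by simp
next
  case False
  then show ?thesis by (simp only: edge_coord_def if_False split: if_split) simp
qed

lemma edge_coord_range: "e \<in> E \<Longrightarrow> edge_coord e x \<in> {0..l e}"
  using edge_coord_cases[of e x] edge_pos[of e] by auto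

lemma edge_coord_eq_imp_eq:
  assumes "e \<in> E" "edge_coord e x = c" "c \<in> {0<..<l e}"
  shows "x = \<phi> e c"
  using assms edge_coord_cases[OF assms(1), of x] by auto

section \<open>The path metric\<close>

text \<open>
  A step inside one edge changes no other coordinate, so all coordinates together map the tree to
  \<open>\<real>\<^sup>E\<close> with the sum norm without increasing distances.
\<close>

lemma edge_coord_le_chain:
  assumes "edge_chain T E l \<phi> x c y"
  shows "(\<Sum>e\<in>E. \<bar>edge_coord e x - edge_coord e y\<bar>) \<le> c"
  using assms
proof (induction rule: edge_chain.induct)
  case (step x c e s t)
  have "(\<Sum>f\<in>E. \<bar>edge_coord f x - edge_coord f (\<phi> e t)\<bar>)
      \<le> (\<Sum>f\<in>E. \<bar>edge_coord f x - edge_coord f (\<phi> e s)\<bar> + (if f = e then \<bar>s - t\<bar> else 0))"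
  proof (rule sum_mono)
    fix f assume f: "f \<in> E"
    show "\<bar>edge_coord f x - edge_coord f (\<phi> e t)\<bar>
        \<le> \<bar>edge_coord f x - edge_coord f (\<phi> e s)\<bar> + (if f = e then \<bar>s - t\<bar> else 0)"
      using step.hyps f by (cases "f = e") (auto simp: edge_coord_own_edge edge_coord_other_edge)
  qed
  also have "\<dots> = (\<Sum>f\<in>E. \<bar>edge_coord f x - edge_coord f (\<phi> e s)\<bar>) + \<bar>s - t\<bar>"
    using step.hyps finite_E by (simp add: sum.distrib)
  finally show ?case using step.IH by linarith
qed simp

lemma edge_chain_to_adjacent_vertex:
  assumes chain: "edge_chain T E l \<phi> x c u" and uw: "(u, w) \<in> E \<union> E\<inverse>"
  shows "\<exists>c'. edge_chain T E l \<phi> x c' w"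
proof -
  obtain e where e: "e \<in> E" "e = (u, w) \<or> e = (w, u)" using uw by auto
  have ends: "0 \<in> {0..l e}" "l e \<in> {0..l e}" using edge_pos[OF e(1)] by auto
  show ?thesis
    using e(2)
  proof
    assume "e = (u, w)"
    then show ?thesis
      using edge_chain.step[of T E l \<phi> x c e 0 "l e"] chain e ends edge_start[OF e(1)] edge_end[OF e(1)] by auto
  next
    assume "e = (w, u)"
    then show ?thesis
      using edge_chain.step[of T E l \<phi> x c e "l e" 0] chain e ends edge_start[OF e(1)] edge_end[OF e(1)] by auto
  qed
qed

lemma edge_chain_exists:
  assumes x: "x \<in> T" and y: "y \<in> T"
  shows "\<exists>c. edge_chain T E l \<phi> x c y"
proof -
  have "\<exists>u\<in>V. \<exists>c. edge_chain T E l \<phi> x c u"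
  proof (cases "x \<in> V")
    case True
    then show ?thesis using x edge_chain.refl by metis
  next
    case False
    then obtain e s where es: "e \<in> E" "s \<in> {0..l e}" "x = \<phi> e s" using x T_eq by auto
    then have "edge_chain T E l \<phi> x (0 + \<bar>s - 0\<bar>) (\<phi> e 0)"
      using x edge_pos[OF es(1)] by (intro edge_chain.step) (auto intro: edge_chain.refl)
    then show ?thesis using es edge_start edge_vertices by metis
  qed
  then obtain u c where u: "u \<in> V" "edge_chain T E l \<phi> x c u" by blast
  have reach: "\<exists>c. edge_chain T E l \<phi> x c w" if "w \<in> V" for w
  proof -
    have "(u, w) \<in> (E \<union> E\<inverse>)\<^sup>*"
      using comb u that by (auto simp: combinatorial_tree_def)
    then show ?thesis
    proof (induction rule: rtrancl_induct)
      case base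
      show ?case using u by blast
    next
      case (step y z)
      then show ?case using edge_chain_to_adjacent_vertex by blast
    qed
  qed
  show ?thesis
  proof (cases "y \<in> V")
    case True
    then show ?thesis using reach by blast
  next
    case False
    then obtain e t where et: "e \<in> E" "t \<in> {0..l e}" "y = \<phi> e t" using y T_eq by auto
    obtain c where "edge_chain T E l \<phi> x c (\<phi> e 0)"
      using reach edge_start edge_vertices et by metis
    then have "edge_chain T E l \<phi> x (c + \<bar>0 - t\<bar>) y"
      unfolding et(3) using et by (intro edge_chain.step) auto
    then show ?thesis by blast
  qed
qed

lemma sum_edge_coord_le_dist:
  assumes "x \<in> T" "y \<in> T"
  shows "(\<Sum>e\<in>E. \<bar>edge_coord e x - edge_coord e y\<bar>) \<le> dist x y"
  unfolding dist_eq[OF assms]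
  using edge_chain_exists[OF assms] edge_coord_le_chain by (intro cInf_greatest) auto

lemma edge_coord_lipschitz:
  assumes "e \<in> E" "x \<in> T" "y \<in> T"
  shows "\<bar>edge_coord e x - edge_coord e y\<bar> \<le> dist x y"
  using sum_edge_coord_le_dist[OF assms(2,3)] finite_E assms(1)
    member_le_sum[of e E "\<lambda>e. \<bar>edge_coord e x - edge_coord e y\<bar>"] by fastforce

lemma dist_edge_le:
  assumes "e \<in> E" "s \<in> {0..l e}" "t \<in> {0..l e}"
  shows "dist (\<phi> e s) (\<phi> e t) \<le> \<bar>s - t\<bar>"
  unfolding dist_eq[OF edge_in_T[OF assms(1,2)] edge_in_T[OF assms(1,3)]]
proof (rule cInf_lower)
  have "edge_chain T E l \<phi> (\<phi> e s) (0 + \<bar>s - t\<bar>) (\<phi> e t)"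
    using assms edge_in_T by (intro edge_chain.step edge_chain.refl) auto
  then show "\<bar>s - t\<bar> \<in> {c. edge_chain T E l \<phi> (\<phi> e s) c (\<phi> e t)}" by simp
  have "0 \<le> c" if "edge_chain T E l \<phi> x c y" for x c y
    using that by (induction rule: edge_chain.induct) auto
  then show "bdd_below {c. edge_chain T E l \<phi> (\<phi> e s) c (\<phi> e t)}" by (auto simp: bdd_below_def)
qed

lemma continuous_on_edge_coord: "e \<in> E \<Longrightarrow> continuous_on T (edge_coord e)"
  unfolding continuous_on_iff
  using edge_coord_lipschitz by (metis dist_real_def dist_commute le_less_trans)

lemma continuous_on_edge: "e \<in> E \<Longrightarrow> continuous_on {0..l e} (\<phi> e)"
  unfolding continuous_on_iff
  using dist_edge_le by (metis dist_real_def dist_commute le_less_trans)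

lemma compact_T: "compact T"
proof -
  have "compact (\<phi> e ` {0..l e})" if "e \<in> E" for e
    using that by (intro compact_continuous_image continuous_on_edge) auto
  then show ?thesis
    unfolding T_eq by (intro compact_Un compact_UN finite_imp_compact[OF finite_V] finite_E)
qed

lemma connected_T: "connected T"
  unfolding connected_iff_connected_component
proof (intro ballI)
  fix x y assume "x \<in> T" "y \<in> T"
  then obtain c where "edge_chain T E l \<phi> x c y" using edge_chain_exists by blast
  then show "connected_component T x y"
  proof (induction rule: edge_chain.induct)
    case (refl x)
    then show ?case by simp
  next
    case (step x c e s t)
    have "connected (\<phi> e ` {0..l e})"
      using step.hyps by (intro connected_continuous_image continuous_on_edge) auto
    then have "connected_component T (\<phi> e s) (\<phi> e t)"
      unfolding connected_component_def using step.hyps edge_in_T[OF step.hyps(2)]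
      by (intro exI[of _ "\<phi> e ` {0..l e}"]) auto
    then show ?case using step.IH connected_component_trans by blast
  qed
qed

text \<open>
  The distance from one of two points at maximal distance maps the connected tree onto \<open>[0, D]\<close>,
  and it maps a ball into an interval whose length is twice the radius.
\<close>

lemma diameter_le_sum_radii:
  assumes cover: "realizes_cover T m v \<rho>" and \<rho>: "\<And>i. i < m \<Longrightarrow> 0 \<le> \<rho> i"
  shows "diameter T \<le> (\<Sum>i<m. 2 * \<rho> i)"
proof -
  have "T \<noteq> {}" using T_eq V_nonempty by blast
  then obtain a b where ab: "a \<in> T" "b \<in> T" "dist a b = diameter T"
    using diameter_compact_attained[OF compact_T] by blast
  have "connected (dist a ` T)"
    by (intro connected_continuous_image connected_T continuous_intros)
  then have "{0..diameter T} \<subseteq> dist a ` T"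
    using ab by (intro connected_contains_Icc) force+
  also have "\<dots> \<subseteq> (\<Union>i<m. {dist a (v i) - \<rho> i..dist a (v i) + \<rho> i})"
  proof (rule image_subsetI)
    fix x assume "x \<in> T"
    then obtain i where i: "i < m" "dist x (v i) \<le> \<rho> i"
      using cover by (auto simp: realizes_cover_def tree_ball_def)
    have "dist a x \<in> {dist a (v i) - \<rho> i..dist a (v i) + \<rho> i}"
      using dist_triangle[of a x "v i"] dist_triangle[of a "v i" x] i by (simp add: dist_commute)
    then show "dist a x \<in> (\<Union>i<m. {dist a (v i) - \<rho> i..dist a (v i) + \<rho> i})" using i by blast
  qed
  finally show ?thesis
    using \<rho> by (intro length_le_sum_of_covering_balls[of "{}"]) auto
qed

section \<open>Arcs and their traces\<close>

text \<open>
  An arc cannot turn back inside an edge: it would meet a point of that edge twice.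
\<close>

lemma edge_coord_between_on_arc:
  assumes g: "arc g" "path_image g \<subseteq> T" and e: "e \<in> E"
    and order: "0 \<le> p" "p \<le> q" "q \<le> s" "s \<le> 1"
  shows "edge_coord e (g q) \<in>
    {min (edge_coord e (g p)) (edge_coord e (g s))..max (edge_coord e (g p)) (edge_coord e (g s))}"
proof (rule between_if_interior_values_simple[OF _ _ _ order, where lo = 0 and hi = "l e"])
  have gT: "g t \<in> T" if "t \<in> {0..1}" for t
    using g(2) that by (auto simp: path_image_def)
  have "continuous_on {0..1} (edge_coord e \<circ> g)"
    using g arc_imp_path[OF g(1)] continuous_on_edge_coord[OF e]
    by (intro continuous_on_compose) (auto simp: path_def path_image_def intro: continuous_on_subset)
  then show "continuous_on {0..1} (\<lambda>t. edge_coord e (g t))" by (simp add: o_def)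
  show "edge_coord e (g t) \<in> {0..l e}" if "t \<in> {0..1}" for t
    using e by (rule edge_coord_range)
  show "t = u" if "t \<in> {0..1}" "u \<in> {0..1}" "edge_coord e (g t) = edge_coord e (g u)"
    "edge_coord e (g t) \<in> {0<..<l e}" for t u
  proof -
    have "g t = g u"
      using edge_coord_eq_imp_eq[OF e] that by metis
    then show ?thesis using g(1) that by (auto simp: arc_def inj_on_def)
  qed
qed

lemma closed_edge_trace:
  assumes "e \<in> E" "closed S"
  shows "closed {s\<in>{0..l e}. \<phi> e s \<in> S}"
  using continuous_closed_preimage[OF continuous_on_edge[OF assms(1)] _ assms(2)]
  by (simp add: vimage_def Int_def)

lemma closed_tree_ball: "closed (tree_ball T v \<rho>)"
proof -
  have "tree_ball T v \<rho> = T \<inter> cball v \<rho>"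
    by (auto simp: tree_ball_def dist_commute)
  then show ?thesis using compact_imp_closed[OF compact_T] by (simp add: closed_Int)
qed

text \<open>
  The arc meets the ball for a first and a last time. In between, every coordinate stays between its
  values at these two points, so the length there is at most the sum of the coordinate differences of
  two points of the ball, hence at most their distance.
\<close>

lemma length_trace_le:
  assumes g: "arc g" "path_image g \<subseteq> T" and \<rho>: "0 \<le> \<rho>"
  shows "tree_length E l \<phi> (tree_ball T v \<rho> \<inter> path_image g) \<le> 2 * \<rho>"
proof (cases "tree_ball T v \<rho> \<inter> path_image g = {}")
  case True
  then show ?thesis using \<rho> by (simp add: tree_length_def)
next
  case False
  define K where "K = {t\<in>{0..1}. g t \<in> tree_ball T v \<rho>}"
  have "continuous_on {0..1} g" using g(1) by (simp add: arc_def path_def)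
  then have "closed ({0..1} \<inter> g -` tree_ball T v \<rho>)"
    by (intro continuous_closed_preimage closed_tree_ball) auto
  then have "compact ({0..1} \<inter> ({0..1} \<inter> g -` tree_ball T v \<rho>))"
    by (intro compact_Int_closed) auto
  also have "{0..1} \<inter> ({0..1} \<inter> g -` tree_ball T v \<rho>) = K" by (auto simp: K_def)
  finally have "compact K" .
  moreover have "K \<noteq> {}" using False by (auto simp: K_def path_image_def)
  ultimately obtain p q where pq: "p \<in> K" "q \<in> K" "\<And>t. t \<in> K \<Longrightarrow> p \<le> t \<and> t \<le> q"
    using compact_attains_inf compact_attains_sup by metis
  have ball: "g p \<in> T" "g q \<in> T" "dist (g p) v \<le> \<rho>" "dist (g q) v \<le> \<rho>"
    using pq(1,2) by (auto simp: K_def tree_ball_def)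
  have "tree_length E l \<phi> (tree_ball T v \<rho> \<inter> path_image g)
      \<le> (\<Sum>e\<in>E. \<bar>edge_coord e (g p) - edge_coord e (g q)\<bar>)"
    unfolding tree_length_def
  proof (rule sum_mono)
    fix e assume e: "e \<in> E"
    let ?I = "{min (edge_coord e (g p)) (edge_coord e (g q))..max (edge_coord e (g p)) (edge_coord e (g q))}"
    have "{s\<in>{0..l e}. \<phi> e s \<in> tree_ball T v \<rho> \<inter> path_image g} \<subseteq> ?I"
    proof
      fix s assume s: "s \<in> {s\<in>{0..l e}. \<phi> e s \<in> tree_ball T v \<rho> \<inter> path_image g}"
      then obtain t where t: "t \<in> {0..1}" "\<phi> e s = g t" by (auto simp: path_image_def)
      then have "t \<in> K" using s by (auto simp: K_def)
      then have "edge_coord e (g t) \<in> ?I"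
        using pq by (intro edge_coord_between_on_arc g e) (auto simp: K_def)
      then show "s \<in> ?I" using edge_coord_own_edge[OF e, of s] s t(2) by auto
    qed
    moreover have "{s\<in>{0..l e}. \<phi> e s \<in> tree_ball T v \<rho> \<inter> path_image g} \<in> sets lborel"
      using closed_edge_trace[OF e closed_Int[OF closed_tree_ball compact_imp_closed[OF compact_arc_image[OF g(1)]]]]
      by simp
    ultimately have "measure lborel {s\<in>{0..l e}. \<phi> e s \<in> tree_ball T v \<rho> \<inter> path_image g} \<le> measure lborel ?I"
      by (intro measure_mono_fmeasurable) (auto intro!: fmeasurable_compact)
    then show "measure lborel {s\<in>{0..l e}. \<phi> e s \<in> tree_ball T v \<rho> \<inter> path_image g}
        \<le> \<bar>edge_coord e (g p) - edge_coord e (g q)\<bar>"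
      by (auto simp: min_def max_def split: if_splits)
  qed
  also have "\<dots> \<le> dist (g p) (g q)"
    using ball by (intro sum_edge_coord_le_dist)
  also have "\<dots> \<le> 2 * \<rho>"
    using dist_triangle2[of "g p" "g q" v] ball by simp
  finally show ?thesis .
qed

text \<open>
  Every point of the arc lies in one of the segments that its coordinates sweep out, and the
  distance from its starting point, being \<open>1\<close>-Lipschitz, does not lengthen these segments.
\<close>

lemma dist_le_sum_edge_coord_on_arc:
  assumes g: "arc g" "path_image g \<subseteq> T"
  shows "dist (pathstart g) (pathfinish g)
    \<le> (\<Sum>e\<in>E. \<bar>edge_coord e (pathstart g) - edge_coord e (pathfinish g)\<bar>)"
proof -
  let ?a = "pathstart g" and ?b = "pathfinish g"
  let ?h = edge_coord
  define mid where "mid e = (?h e ?a + ?h e ?b) / 2" for e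
  define half where "half e = \<bar>?h e ?a - ?h e ?b\<bar> / 2" for e
  define f where "f e = dist ?a (\<phi> e (mid e))" for e
  \<comment> \<open>A ball on the line around the image of the midpoint of a swept segment contains the image of that segment.\<close>
  have mid: "mid e \<in> {0..l e}" if "e \<in> E" for e
    using edge_coord_range[OF that, of ?a] edge_coord_range[OF that, of ?b] by (auto simp: mid_def)
  have "connected (dist ?a ` path_image g)"
    using g(1) by (intro connected_continuous_image connected_arc_image continuous_intros)
  then have "{0..dist ?a ?b} \<subseteq> dist ?a ` path_image g"
    by (intro connected_contains_Icc) (force simp: pathstart_in_path_image pathfinish_in_path_image)+
  also have "\<dots> \<subseteq> dist ?a ` V \<union> (\<Union>e\<in>E. {f e - half e..f e + half e})"
  proof (rule image_subsetI)
    fix x assume x: "x \<in> path_image g"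
    then obtain t where t: "t \<in> {0..1}" "x = g t" by (auto simp: path_image_def)
    consider "x \<in> V" | e s where "e \<in> E" "s \<in> {0..l e}" "x = \<phi> e s"
      using x g(2) T_eq by blast
    then show "dist ?a x \<in> dist ?a ` V \<union> (\<Union>e\<in>E. {f e - half e..f e + half e})"
    proof cases
      case 1
      then show ?thesis by blast
    next
      case (2 e s)
      have "s = ?h e x" using edge_coord_own_edge 2 by simp
      also have "\<dots> \<in> {min (?h e ?a) (?h e ?b)..max (?h e ?a) (?h e ?b)}"
        unfolding t(2) pathstart_def pathfinish_def
        using t(1) by (intro edge_coord_between_on_arc g 2) auto
      finally have "\<bar>s - mid e\<bar> \<le> half e"
        by (auto simp: mid_def half_def abs_if min_def max_def field_simps split: if_splits)
      then have "dist x (\<phi> e (mid e)) \<le> half e"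
        using dist_edge_le[OF 2(1,2) mid[OF 2(1)]] 2(3) by simp
      then have "dist ?a x \<in> {f e - half e..f e + half e}"
        using dist_triangle[of ?a x "\<phi> e (mid e)"] dist_triangle[of ?a "\<phi> e (mid e)" x]
        by (simp add: f_def dist_commute)
      then show ?thesis using 2(1) by blast
    qed
  qed
  finally have "dist ?a ?b \<le> (\<Sum>e\<in>E. 2 * half e)"
    using finite_V finite_E by (intro length_le_sum_of_covering_balls) (auto simp: half_def)
  then show ?thesis by (simp add: half_def)
qed

text \<open>
  Along the arc the coordinate of an edge takes every value between those at its ends, and such a
  value names a single point of the edge, which is then a point of the arc in one of the balls.
\<close>

lemma sum_edge_coord_le_sum_traces:
  assumes g: "arc g" "path_image g \<subseteq> T" and cover: "realizes_cover T m v \<rho>"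
  shows "(\<Sum>e\<in>E. \<bar>edge_coord e (pathstart g) - edge_coord e (pathfinish g)\<bar>)
    \<le> (\<Sum>i<m. tree_length E l \<phi> (tree_ball T (v i) (\<rho> i) \<inter> path_image g))"
proof -
  let ?J = "\<lambda>i. tree_ball T (v i) (\<rho> i) \<inter> path_image g"
  let ?S = "\<lambda>e i. {s\<in>{0..l e}. \<phi> e s \<in> ?J i}"
  have "\<bar>edge_coord e (pathstart g) - edge_coord e (pathfinish g)\<bar> \<le> (\<Sum>i<m. measure lborel (?S e i))"
    if e: "e \<in> E" for e
  proof -
    let ?a = "edge_coord e (pathstart g)" and ?b = "edge_coord e (pathfinish g)"
    have S: "?S e i \<in> fmeasurable lborel" for i
    proof -
      have "closed (?S e i)"
        by (intro closed_edge_trace e closed_Int closed_tree_ball compact_imp_closed compact_arc_image g)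
      then have "compact ({0..l e} \<inter> ?S e i)" by (intro compact_Int_closed) auto
      then have "compact (?S e i)" by (simp add: Int_def conj_ac cong: conj_cong)
      then show ?thesis by (rule fmeasurable_compact)
    qed
    have conn: "connected (edge_coord e ` path_image g)"
      using g by (intro connected_continuous_image connected_arc_image
          continuous_on_subset[OF continuous_on_edge_coord[OF e]])
    have ends: "?a \<in> edge_coord e ` path_image g" "?b \<in> edge_coord e ` path_image g" by auto
    have img: "{min ?a ?b..max ?a ?b} \<subseteq> edge_coord e ` path_image g"
      using ends by (intro connected_contains_Icc conn) (auto simp: min_def max_def)
    \<comment> \<open>Open segment: at the two ends the coordinate does not determine the point.\<close>
    have sub: "{min ?a ?b<..<max ?a ?b} \<subseteq> (\<Union>i<m. ?S e i)"
    proof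
      fix s assume s: "s \<in> {min ?a ?b<..<max ?a ?b}"
      then have "s \<in> {min ?a ?b..max ?a ?b}" by simp
      then obtain x where x: "x \<in> path_image g" "edge_coord e x = s"
        using img by blast
      have "s \<in> {0<..<l e}"
        using s edge_coord_range[OF e, of "pathstart g"] edge_coord_range[OF e, of "pathfinish g"]
        by (auto simp: min_def max_def split: if_splits)
      moreover from this have "x = \<phi> e s"
        using edge_coord_eq_imp_eq[OF e x(2)] by blast
      moreover obtain i where "i < m" "x \<in> tree_ball T (v i) (\<rho> i)"
        using cover x(1) g(2) by (auto simp: realizes_cover_def)
      ultimately show "s \<in> (\<Union>i<m. ?S e i)" using x(1) by auto
    qed
    have "\<bar>?a - ?b\<bar> = measure lborel {min ?a ?b<..<max ?a ?b}"
      by (auto simp: min_def max_def)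
    also have "\<dots> \<le> measure lborel (\<Union>i<m. ?S e i)"
      using S by (intro measure_mono_fmeasurable sub fmeasurable.finite_UN) auto
    also have "\<dots> \<le> (\<Sum>i<m. measure lborel (?S e i))"
      using fmeasurableD[OF S] by (intro measure_UNION_le) auto
    finally show ?thesis .
  qed
  then have "(\<Sum>e\<in>E. \<bar>edge_coord e (pathstart g) - edge_coord e (pathfinish g)\<bar>)
      \<le> (\<Sum>e\<in>E. \<Sum>i<m. measure lborel (?S e i))" by (rule sum_mono)
  also have "\<dots> = (\<Sum>i<m. tree_length E l \<phi> (?J i))"
    unfolding tree_length_def by (rule sum.swap)
  finally show ?thesis .
qed

end

section \<open>First moments of the radius measures\<close>

lemma space_cover_space: "space (cover_space T) = (SIGMA m:{1..}. covers T m)"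
proof -
  have "covers T m \<subseteq> {..<m} \<rightarrow>\<^sub>E {0..}" for m by (auto simp: covers_def)
  then show ?thesis
    unfolding cover_space_def
    by (intro space_measure_of) (auto simp: sets_restrict_space dest!: sets.sets_into_space)
qed

lemma covers_nonneg: "\<rho> \<in> covers T m \<Longrightarrow> i < m \<Longrightarrow> 0 \<le> \<rho> i"
  by (force simp: covers_def PiE_def Pi_def)

lemma sets_radius_measure: "sets (radius_measure \<nu>) = sets nonneg_borel"
  unfolding radius_measure_def
  using sets.sigma_sets_eq[of nonneg_borel] sets.space_closed[of nonneg_borel]
  by (simp add: space_restrict_space)

lemma radius_count_eq_sum_indicator:
  "of_nat (radius_count A (m, \<rho>)) = (\<Sum>i<m. indicator A (\<rho> i) :: ennreal)"
  by (simp add: radius_count_def indicator_def sum.If_cases Int_def)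

text \<open>
  The change of variables formula for \<open>E\<^sub>\<nu>\<close>. Measurability of the sum over the radii is part of the
  induction, since for indicators it is what is known about the counting function.
\<close>

lemma nn_integral_radius_measure:
  assumes s: "sets \<nu> = sets (cover_space T)" and f: "f \<in> borel_measurable nonneg_borel"
  shows "(\<lambda>(m, \<rho>). \<Sum>i<m. f (\<rho> i) :: ennreal) \<in> borel_measurable \<nu> \<and>
    (\<integral>\<^sup>+x. f x \<partial>radius_measure \<nu>) = (\<integral>\<^sup>+(m, \<rho>). (\<Sum>i<m. f (\<rho> i)) \<partial>\<nu>)"
proof -
  define F where "F f x = (\<Sum>i<fst x. f (snd x i))" for f :: "real \<Rightarrow> ennreal" and x :: "nat \<times> (nat \<Rightarrow> real)"
  note sets_R = sets_radius_measure[of \<nu>]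
  have space_R: "space (radius_measure \<nu>) = {0..}"
    using sets_eq_imp_space_eq[OF sets_R] by (simp add: space_restrict_space)
  have meas_R: "borel_measurable (radius_measure \<nu>) = (borel_measurable nonneg_borel :: (real \<Rightarrow> ennreal) set)"
    by (rule measurable_cong_sets[OF sets_R]) simp
  have space: "space \<nu> = (SIGMA m:{1..}. covers T m)"
    using sets_eq_imp_space_eq[OF s] by (simp add: space_cover_space)
  have "F f \<in> borel_measurable \<nu> \<and> (\<integral>\<^sup>+x. f x \<partial>radius_measure \<nu>) = (\<integral>\<^sup>+x. F f x \<partial>\<nu>)"
    using f
  proof (induction rule: borel_measurable_induct)
    case (cong f g)
    have "F f x = F g x" if "x \<in> space \<nu>" for x
      using that cong.hyps(3) covers_nonneg[of _ T]
      by (auto simp: F_def space space_restrict_space intro!: sum.cong)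
    moreover have "(\<integral>\<^sup>+x. f x \<partial>radius_measure \<nu>) = (\<integral>\<^sup>+x. g x \<partial>radius_measure \<nu>)"
      using cong.hyps(3) by (intro nn_integral_cong) (simp add: space_R space_restrict_space)
    ultimately show ?case
      using cong.IH by (simp cong: measurable_cong nn_integral_cong_simp)
  next
    case (set A)
    have "F (indicator A) = (\<lambda>x. of_nat (radius_count A x))"
      by (auto simp: F_def radius_count_eq_sum_indicator fun_eq_iff)
    then show ?case
      using radius_count_meas[OF set s] emeasure_radius_measure[OF set s] set sets_R by simp
  next
    case (mult u c)
    have "F (\<lambda>x. c * u x) = (\<lambda>x. c * F u x)"
      by (simp add: F_def sum_distrib_left fun_eq_iff)
    moreover have [measurable]: "F u \<in> borel_measurable \<nu>"
      using mult.IH by simp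
    ultimately show ?case
      using mult by (simp add: nn_integral_cmult meas_R)
  next
    case (add u v)
    have "F (\<lambda>x. v x + u x) = (\<lambda>x. F v x + F u x)"
      by (simp add: F_def sum.distrib fun_eq_iff)
    moreover have [measurable]: "F u \<in> borel_measurable \<nu>" "F v \<in> borel_measurable \<nu>"
      using add.IH by simp_all
    ultimately show ?case
      using add by (simp add: nn_integral_add meas_R)
  next
    case (seq U)
    have "F (SUP i. U i) = (\<lambda>x. SUP i. F (U i) x)"
    proof
      fix x :: "nat \<times> (nat \<Rightarrow> real)"
      obtain m \<rho> where x: "x = (m, \<rho>)" by force
      have "(SUP n. \<Sum>i<m. U n (\<rho> i)) = (\<Sum>i<m. SUP n. U n (\<rho> i))"
        using seq.hyps by (intro ennreal_SUP_sum) (auto simp: incseq_def le_fun_def)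
      then show "F (SUP i. U i) x = (SUP i. F (U i) x)"
        by (simp add: F_def x image_comp)
    qed
    moreover have "incseq (\<lambda>i. F (U i))"
      using seq.hyps by (auto simp: F_def incseq_def le_fun_def intro!: sum_mono)
    moreover have "(\<integral>\<^sup>+x. (SUP i. U i) x \<partial>radius_measure \<nu>) = (SUP i. \<integral>\<^sup>+x. U i x \<partial>radius_measure \<nu>)"
      using seq.hyps by (simp add: image_comp nn_integral_monotone_convergence_SUP meas_R)
    moreover have [measurable]: "F (U i) \<in> borel_measurable \<nu>" for i
      using seq.IH by simp
    ultimately show ?case
      using seq.IH by (simp add: nn_integral_monotone_convergence_SUP del: SUP_apply Sup_apply)
  qed
  then show ?thesis by (simp add: F_def[abs_def] case_prod_beta')
qed

lemma nn_integral_sum_of_measures: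
  fixes M N K :: "'a measure" and f :: "'a \<Rightarrow> ennreal"
  assumes sets: "sets M = sets K" "sets N = sets K"
    and sum: "\<And>A. A \<in> sets K \<Longrightarrow> emeasure M A + emeasure N A = emeasure K A"
    and f: "f \<in> borel_measurable K"
  shows "(\<integral>\<^sup>+x. f x \<partial>M) + (\<integral>\<^sup>+x. f x \<partial>N) = (\<integral>\<^sup>+x. f x \<partial>K)"
proof -
  have meas: "borel_measurable M = (borel_measurable K :: ('a \<Rightarrow> ennreal) set)"
    "borel_measurable N = (borel_measurable K :: ('a \<Rightarrow> ennreal) set)"
    using sets by (simp_all cong: measurable_cong_sets)
  note space = sets[THEN sets_eq_imp_space_eq]
  show ?thesis
    using f
  proof (induction rule: borel_measurable_induct)
    case (cong f g)
    then show ?case by (simp add: space cong: nn_integral_cong_simp)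
  next
    case (set A)
    then show ?case by (simp add: sets sum)
  next
    case (mult u c)
    then show ?case by (simp add: nn_integral_cmult meas distrib_left[symmetric])
  next
    case (add u v)
    have "(\<integral>\<^sup>+x. v x + u x \<partial>M) + (\<integral>\<^sup>+x. v x + u x \<partial>N)
        = ((\<integral>\<^sup>+x. v x \<partial>M) + (\<integral>\<^sup>+x. v x \<partial>N)) + ((\<integral>\<^sup>+x. u x \<partial>M) + (\<integral>\<^sup>+x. u x \<partial>N))"
      using add.hyps by (simp add: nn_integral_add meas ac_simps)
    then show ?case using add by (simp add: nn_integral_add)
  next
    case (seq U)
    have mono: "incseq (\<lambda>i. \<integral>\<^sup>+x. U i x \<partial>M)" "incseq (\<lambda>i. \<integral>\<^sup>+x. U i x \<partial>N)"
      using seq.hyps by (auto simp: incseq_def le_fun_def intro!: nn_integral_mono)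
    show ?case
      using seq.hyps seq.IH mono
      by (simp add: image_comp nn_integral_monotone_convergence_SUP meas ennreal_SUP_add[symmetric])
  qed
qed

lemma sets_scaled_uniform: "sets (scaled_uniform L r) = sets nonneg_borel"
  by (simp add: scaled_uniform_def sets_restrict_space)

lemma emeasure_scaled_uniform:
  assumes r: "0 < r" and A: "A \<in> sets nonneg_borel"
  shows "emeasure (scaled_uniform L r) A
    = ennreal (L / r) * (emeasure lborel ({0..r} \<inter> A) / ennreal r)"
proof -
  let ?M = "restrict_space lborel {0::real..}"
  have sets: "{0..r} \<in> sets ?M" "A \<in> sets ?M"
    using A by (auto simp: sets_restrict_space)
  have "emeasure ?M {0..r} = ennreal r"
    using r by (subst emeasure_restrict_space) auto
  moreover have "emeasure ?M ({0..r} \<inter> A) = emeasure lborel ({0..r} \<inter> A)"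
    by (subst emeasure_restrict_space) auto
  ultimately show ?thesis
    using sets by (simp add: scaled_uniform_def)
qed

lemma first_moment_scaled_uniform:
  assumes r: "0 < r" and L: "0 \<le> L"
  shows "(\<integral>\<^sup>+s. ennreal s \<partial>scaled_uniform L r) = ennreal (L / 2)"
proof -
  let ?M = "restrict_space lborel {0::real..}"
  have [measurable]: "(\<lambda>s. ennreal s) \<in> borel_measurable ?M"
    by (intro measurable_restrict_space1) simp
  have sets: "{0..r} \<in> sets ?M" by (auto simp: sets_restrict_space)
  have mass: "emeasure ?M {0..r} = ennreal r"
    using r by (subst emeasure_restrict_space) auto
  have "(\<integral>\<^sup>+s. ennreal s * indicator {0..r} s \<partial>?M) = (\<integral>\<^sup>+s. ennreal s * indicator {0..r} s \<partial>lborel)"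
    by (subst nn_integral_restrict_space) (auto intro!: nn_integral_cong split: split_indicator)
  also have "\<dots> = ennreal (r\<^sup>2 / 2 - 0\<^sup>2 / 2)"
    using r by (intro nn_integral_FTC_Icc) (auto intro!: derivative_eq_intros)
  finally have "(\<integral>\<^sup>+s. ennreal s * indicator {0..r} s \<partial>?M) = ennreal (r\<^sup>2 / 2)" by simp
  then have "(\<integral>\<^sup>+s. ennreal s \<partial>scaled_uniform L r) = ennreal (L / r) * (ennreal (r\<^sup>2 / 2) / ennreal r)"
    using sets by (simp add: scaled_uniform_def nn_integral_scale_measure nn_integral_uniform_measure mass)
  also have "\<dots> = ennreal (L / r * (r\<^sup>2 / 2 / r))"
    using r L by (simp add: divide_ennreal ennreal_mult[symmetric])
  also have "L / r * (r\<^sup>2 / 2 / r) = L / 2"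
    using r by (simp add: power2_eq_square)
  finally show ?thesis .
qed

text \<open>
  The first moment \<open>L / 2\<close> of \<open>\<Lambda>\<close> splits into those of its parts \<open>\<Delta>\<close> and
  \<open>E\<^sub>\<nu>\<close>, and the first moment of \<open>E\<^sub>\<nu>\<close> is the expected sum of the radii. As
  \<open>\<Lambda>\<close> has no mass beyond \<open>r\<close>, neither part has any, so nothing is lost by integrating \<open>\<Delta>\<close>
  over \<open>{0..r}\<close> only.
\<close>

lemma first_moment_balance:
  fixes L r :: real
  assumes L: "0 \<le> L" and r: "0 < r"
    and s: "sets \<nu> = sets (cover_space T)"
    and le: "\<forall>A\<in>sets nonneg_borel. emeasure (radius_measure \<nu>) A \<le> emeasure (scaled_uniform L r) A"
    and Delta: "\<Delta> = diff_measure (scaled_uniform L r) (radius_measure \<nu>)"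
  shows sum_deficit: "\<forall>A\<in>sets nonneg_borel.
        emeasure \<Delta> A + emeasure (radius_measure \<nu>) A = emeasure (scaled_uniform L r) A"
    and AE_radius_le: "AE (m, \<rho>) in \<nu>. \<forall>i<m. \<rho> i \<in> {0..r}"
    and set_integrable_deficit: "set_integrable \<Delta> {0..r} (\<lambda>s. s)"
    and integrable_sum_radii: "integrable \<nu> (\<lambda>(m, \<rho>). \<Sum>i<m. \<rho> i)"
    and moment_balance: "(LINT s:{0..r}|\<Delta>. s) + (\<integral>(m, \<rho>). (\<Sum>i<m. \<rho> i) \<partial>\<nu>) = L / 2"
proof -
  let ?\<Lambda> = "scaled_uniform L r" and ?R = "radius_measure \<nu>"
  let ?S = "\<lambda>(m, \<rho>). \<Sum>i<m. \<rho> i :: real"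
  note sets_R = sets_radius_measure[of \<nu>]
  have sets_D: "sets \<Delta> = sets nonneg_borel"
    by (simp add: Delta sets_scaled_uniform)
  have space_D: "space \<Delta> = {0..}"
    using sets_eq_imp_space_eq[OF sets_D] by (simp add: space_restrict_space)
  have space: "space \<nu> = (SIGMA m:{1..}. covers T m)"
    using sets_eq_imp_space_eq[OF s] by (simp add: space_cover_space)
  have finite_\<Lambda>: "emeasure ?\<Lambda> A < \<infinity>" if "A \<in> sets nonneg_borel" for A
  proof -
    have "emeasure lborel ({0..r} \<inter> A) \<le> emeasure lborel {0..r}"
      by (intro emeasure_mono) auto
    then have "emeasure ?\<Lambda> A \<le> ennreal (L / r) * (ennreal r / ennreal r)"
      using r unfolding emeasure_scaled_uniform[OF r that]
      by (intro mult_left_mono divide_right_mono_ennreal) auto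
    then show ?thesis
      using r by (simp add: divide_ennreal le_less_trans)
  qed
  have top: "space ?\<Lambda> \<in> sets nonneg_borel" "space ?R \<in> sets nonneg_borel"
    using sets.top[of ?\<Lambda>] sets.top[of ?R] by (simp_all add: sets_scaled_uniform sets_R)
  have "finite_measure ?\<Lambda>"
    using finite_\<Lambda>[OF top(1)] by (intro finite_measureI) simp
  moreover have "finite_measure ?R"
    using finite_\<Lambda>[OF top(2)] le top(2) by (intro finite_measureI) (auto simp: less_top dest!: bspec)
  ultimately have "emeasure \<Delta> A = emeasure ?\<Lambda> A - emeasure ?R A" if "A \<in> sets nonneg_borel" for A
    using that le unfolding Delta
    by (intro emeasure_diff_measure) (auto simp: sets_scaled_uniform sets_R)
  then show sum: "\<forall>A\<in>sets nonneg_borel. emeasure \<Delta> A + emeasure ?R A = emeasure ?\<Lambda> A"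
    using le by (simp add: diff_add_cancel_ennreal)

  have tail: "{r<..} \<in> sets nonneg_borel"
    using r by (auto simp: sets_restrict_space intro!: image_eqI[of _ _ "{r<..}"])
  have "emeasure ?\<Lambda> {r<..} = 0"
  proof -
    have "{0..r} \<inter> {r<..} = {}" by auto
    then show ?thesis by (simp add: emeasure_scaled_uniform[OF r tail])
  qed
  then have tail_0: "emeasure \<Delta> {r<..} = 0" "emeasure ?R {r<..} = 0"
    using sum tail by (metis add_eq_0_iff_both_eq_0)+
  have "AE x in \<nu>. (of_nat (radius_count {r<..} x) :: ennreal) = 0"
    using tail_0(2) emeasure_radius_measure[OF tail s] radius_count_meas[OF tail s]
    by (simp add: nn_integral_0_iff_AE)
  with AE_space show "AE (m, \<rho>) in \<nu>. \<forall>i<m. \<rho> i \<in> {0..r}"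
  proof eventually_elim
    case (elim x)
    then show ?case
      using covers_nonneg[of _ T] by (cases x) (auto simp: radius_count_eq_sum_indicator space indicator_def)
  qed

  have id_meas: "(\<lambda>s. ennreal s) \<in> borel_measurable nonneg_borel"
    by (intro measurable_restrict_space1) simp
  have S_meas: "?S \<in> borel_measurable \<nu>" and S_nonneg: "AE x in \<nu>. 0 \<le> ?S x"
  proof -
    have eq: "(\<Sum>i<m. ennreal (\<rho> i)) = ennreal (\<Sum>i<m. \<rho> i)" if "(m, \<rho>) \<in> space \<nu>" for m \<rho>
      using that covers_nonneg[of _ T] by (intro sum_ennreal) (auto simp: space)
    have [measurable]: "(\<lambda>(m, \<rho>). \<Sum>i<m. ennreal (\<rho> i)) \<in> borel_measurable \<nu>"
      using nn_integral_radius_measure[OF s id_meas] by blast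
    have "(\<lambda>x. enn2real ((\<lambda>(m, \<rho>). \<Sum>i<m. ennreal (\<rho> i)) x)) \<in> borel_measurable \<nu>"
      by measurable
    moreover have "enn2real ((\<lambda>(m, \<rho>). \<Sum>i<m. ennreal (\<rho> i)) x) = ?S x" if "x \<in> space \<nu>" for x
      using that eq covers_nonneg[of _ T] by (cases x) (auto simp: space intro!: enn2real_ennreal sum_nonneg)
    ultimately show "?S \<in> borel_measurable \<nu>" by (simp cong: measurable_cong)
    show "AE x in \<nu>. 0 \<le> ?S x"
      using covers_nonneg[of _ T] by (intro AE_I2) (auto simp: space intro!: sum_nonneg)
  qed
  have R_moment: "(\<integral>\<^sup>+s. ennreal s \<partial>?R) = (\<integral>\<^sup>+x. ennreal (?S x) \<partial>\<nu>)"
    unfolding nn_integral_radius_measure[OF s id_meas, THEN conjunct2]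
    using covers_nonneg[of _ T] by (intro nn_integral_cong) (auto simp: space intro!: sum_ennreal)
  have total: "(\<integral>\<^sup>+s. ennreal s \<partial>\<Delta>) + (\<integral>\<^sup>+x. ennreal (?S x) \<partial>\<nu>) = ennreal (L / 2)"
    unfolding R_moment[symmetric] first_moment_scaled_uniform[OF r L, symmetric]
    using id_meas sum
    by (intro nn_integral_sum_of_measures)
      (auto simp: sets_D sets_R sets_scaled_uniform cong: measurable_cong_sets)

  have "AE s in \<Delta>. s \<in> {0..r}"
    using tail_0(1) tail by (intro AE_I[of _ _ "{r<..}"]) (auto simp: space_D sets_D)
  then have D_moment: "(\<integral>\<^sup>+s. ennreal s \<partial>\<Delta>) = (\<integral>\<^sup>+s. ennreal (indicator {0..r} s *\<^sub>R s) \<partial>\<Delta>)"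
    by (intro nn_integral_cong_AE) (auto elim: eventually_mono)
  have D_meas: "(\<lambda>s. indicator {0..r} s *\<^sub>R s) \<in> borel_measurable \<Delta>"
  proof -
    have "(\<lambda>s. indicator {0..r} s *\<^sub>R s) \<in> borel_measurable nonneg_borel"
      by (intro measurable_restrict_space1) simp
    then show ?thesis by (simp add: sets_D cong: measurable_cong_sets)
  qed
  have fin: "(\<integral>\<^sup>+s. ennreal s \<partial>\<Delta>) \<noteq> top" "(\<integral>\<^sup>+x. ennreal (?S x) \<partial>\<nu>) \<noteq> top"
    using total by (auto simp: ennreal_add_eq_top[symmetric])
  obtain d where d: "0 \<le> d" "(\<integral>\<^sup>+s. ennreal s \<partial>\<Delta>) = ennreal d"
    using fin(1) by (cases rule: ennreal_cases) auto
  obtain e where e: "0 \<le> e" "(\<integral>\<^sup>+x. ennreal (?S x) \<partial>\<nu>) = ennreal e"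
    using fin(2) by (cases rule: ennreal_cases) auto
  have "ennreal (d + e) = ennreal (L / 2)"
    using total d e by (simp only: ennreal_plus)
  then have de: "d + e = L / 2"
    using d(1) e(1) L by (subst (asm) ennreal_inj) auto
  have D_nonneg: "AE s in \<Delta>. 0 \<le> indicator {0..r} s *\<^sub>R s"
    by (auto split: split_indicator)
  show "set_integrable \<Delta> {0..r} (\<lambda>s. s)"
    unfolding set_integrable_def using D_meas D_nonneg d(2)[unfolded D_moment] by (rule integrableI_nn_integral_finite)
  show "integrable \<nu> ?S"
    using S_meas S_nonneg e(2) by (rule integrableI_nn_integral_finite)
  have "(LINT s:{0..r}|\<Delta>. s) = d"
    unfolding set_lebesgue_integral_def
    using D_meas D_nonneg d D_moment by (subst integral_eq_nn_integral) auto
  moreover have "(\<integral>x. ?S x \<partial>\<nu>) = e"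
    using S_meas S_nonneg e by (subst integral_eq_nn_integral) auto
  ultimately show "(LINT s:{0..r}|\<Delta>. s) + (\<integral>(m, \<rho>). (\<Sum>i<m. \<rho> i) \<partial>\<nu>) = L / 2"
    using de by simp
qed

theorem theorem5p12:
  fixes T V :: "'a::metric_space set"
    and E :: "('a \<times> 'a) set"
    and l :: "'a \<times> 'a \<Rightarrow> real"
    and \<phi> :: "'a \<times> 'a \<Rightarrow> real \<Rightarrow> 'a"
    and L D r :: real
    and \<nu> :: "(nat \<times> (nat \<Rightarrow> real)) measure"
    and \<Delta> :: "real measure"
  assumes tree: "metric_tree T V E l \<phi>"
    and nontrivial: "\<not> (\<exists>x. T = {x})"
    and L: "L = total_length E l"
    and D: "D = diameter T"
    and r: "0 < r"
    and prob: "prob_space \<nu>"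
    and sets: "sets \<nu> = sets (cover_space T)"
    and le: "\<forall>A\<in>sets nonneg_borel. emeasure (radius_measure \<nu>) A \<le> emeasure (scaled_uniform L r) A"
    and Delta: "\<Delta> = diff_measure (scaled_uniform L r) (radius_measure \<nu>)"
  shows
    "(\<forall>A\<in>sets nonneg_borel.
        emeasure \<Delta> A + emeasure (radius_measure \<nu>) A = emeasure (scaled_uniform L r) A) \<and>
     (set_integrable \<Delta> {0..r} (\<lambda>s. s) \<and>
      0 \<le> (LINT s:{0..r}|\<Delta>. s) \<and> (LINT s:{0..r}|\<Delta>. s) \<le> (L - D) / 2) \<and>
     (\<forall>t\<in>{0<..r}. emeasure \<Delta> {t..r} \<le> ennreal ((L - D) / (2 * t))) \<and>
     (AE (m, \<rho>) in \<nu>. \<forall>i<m. \<rho> i \<in> {0..r}) \<and>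
     (\<forall>P vm. diameter_path T P \<and> (\<forall>m\<ge>1. selects_centers T r m (vm m)) \<longrightarrow>
        (\<forall>m\<ge>1. \<forall>\<rho>\<in>bounded_covers T r m.
           0 \<le> cover_waste T E l \<phi> P vm (m, \<rho>) \<and> 0 \<le> cover_overlap T E l \<phi> P vm (m, \<rho>)) \<and>
        (let X = (\<lambda>c. cover_waste T E l \<phi> P vm c + cover_overlap T E l \<phi> P vm c) in
           integrable \<nu> X \<and>
           integral\<^sup>L \<nu> X = L - D - 2 * (LINT s:{0..r}|\<Delta>. s) \<and>
           L - D - 2 * (LINT s:{0..r}|\<Delta>. s) \<le> L - D \<and>
           (\<forall>u>0. measure \<nu> {c \<in> space \<nu>. u \<le> X c} \<le> (L - D) / u)))"
proof -
  interpret tr: realized_tree T V E l \<phi> by unfold_locales (rule tree)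
  interpret prob_space \<nu> by (rule prob)
  have L_nonneg: "0 \<le> L"
    unfolding L total_length_def using tr.edge_pos by (intro sum_nonneg) (simp add: less_imp_le)
  let ?I = "LINT s:{0..r}|\<Delta>. s"
  let ?S = "\<lambda>(m, \<rho>). \<Sum>i<m. \<rho> i :: real"
  note moments = first_moment_balance[OF L_nonneg r sets le Delta]
  have space: "space \<nu> = (SIGMA m:{1..}. covers T m)"
    using sets_eq_imp_space_eq[OF sets] by (simp add: space_cover_space)
  have sets_D: "sets \<Delta> = sets nonneg_borel"
    by (simp add: Delta sets_scaled_uniform)

  have D_le: "D \<le> 2 * ?S x" if "x \<in> space \<nu>" for x
  proof -
    obtain m \<rho> where x: "x = (m, \<rho>)" by force
    with that have \<rho>: "\<rho> \<in> covers T m" by (simp add: space)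
    then obtain v where "realizes_cover T m v \<rho>" by (auto simp: covers_def)
    then have "D \<le> (\<Sum>i<m. 2 * \<rho> i)"
      unfolding D using \<rho> by (intro tr.diameter_le_sum_radii) (auto intro: covers_nonneg)
    then show ?thesis by (simp add: x sum_distrib_left)
  qed
  have int_excess: "integrable \<nu> (\<lambda>x. 2 * ?S x - D)"
    using moments(4) by (intro Bochner_Integration.integrable_diff integrable_mult_right) auto
  have "(\<integral>x. 2 * ?S x - D \<partial>\<nu>) = (\<integral>x. 2 * ?S x \<partial>\<nu>) - (\<integral>x. D \<partial>\<nu>)"
    using moments(4) by (intro Bochner_Integration.integral_diff integrable_mult_right) auto
  then have excess: "(\<integral>x. 2 * ?S x - D \<partial>\<nu>) = L - D - 2 * ?I"
    using moments(5) by (simp add: prob_space)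
  have "0 \<le> (\<integral>x. 2 * ?S x - D \<partial>\<nu>)"
    using D_le by (intro integral_nonneg_AE AE_I2) (simp only: diff_ge_0_iff_ge)
  then have I_upper: "?I \<le> (L - D) / 2"
    using excess by simp
  have I_nonneg: "0 \<le> ?I"
    unfolding set_lebesgue_integral_def by (intro integral_nonneg_AE AE_I2) (simp split: split_indicator)

  have tail: "emeasure \<Delta> {t..r} \<le> ennreal ((L - D) / (2 * t))" if t: "t \<in> {0<..r}" for t
  proof -
    have "{s\<in>{0..r}. t \<le> s} = {t..r}" using t by auto
    moreover have "emeasure \<Delta> {s\<in>{0..r}. t \<le> s} \<le> ennreal (1 / t * ?I)"
      using t moments(3) by (intro integral_Markov_inequality') (auto simp: sets_D sets_restrict_space)
    moreover have "1 / t * ?I \<le> (L - D) / (2 * t)"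
      using I_upper t by (simp add: field_simps)
    ultimately show ?thesis
      by (metis ennreal_leI order_trans)
  qed

  have paths: "(\<forall>m\<ge>1. \<forall>\<rho>\<in>bounded_covers T r m.
           0 \<le> cover_waste T E l \<phi> P vm (m, \<rho>) \<and> 0 \<le> cover_overlap T E l \<phi> P vm (m, \<rho>))"
    if P: "diameter_path T P" and vm: "\<forall>m\<ge>1. selects_centers T r m (vm m)" for P vm
  proof (intro allI impI ballI conjI)
    fix m :: nat and \<rho> assume m: "1 \<le> m" and \<rho>: "\<rho> \<in> bounded_covers T r m"
    obtain g where g: "arc g" "path_image g \<subseteq> T" "P = path_image g"
      "dist (pathstart g) (pathfinish g) = D"
      using P by (auto simp: diameter_path_def arc_joining_def D)
    have cover: "realizes_cover T m (vm m \<rho>) \<rho>"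
      using vm m \<rho> by (auto simp: selects_centers_def)
    have \<rho>_nonneg: "0 \<le> \<rho> i" if "i < m" for i
      using \<rho> that by (auto simp: bounded_covers_def intro: covers_nonneg)
    show "0 \<le> cover_waste T E l \<phi> P vm (m, \<rho>)"
      unfolding cover_waste_def trace_length_def g(3)
      using tr.length_trace_le[OF g(1,2) \<rho>_nonneg] by (auto intro!: sum_nonneg)
    have "D \<le> (\<Sum>i<m. tree_length E l \<phi> (tree_ball T (vm m \<rho> i) (\<rho> i) \<inter> P))"
      unfolding g(3) g(4)[symmetric]
      using tr.dist_le_sum_edge_coord_on_arc[OF g(1,2)] tr.sum_edge_coord_le_sum_traces[OF g(1,2) cover]
      by (rule order_trans)
    then show "0 \<le> cover_overlap T E l \<phi> P vm (m, \<rho>)"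
      by (simp add: cover_overlap_def trace_length_def D)
  qed

  have telescope: "cover_waste T E l \<phi> P vm c + cover_overlap T E l \<phi> P vm c = 2 * ?S c - D" for P vm c
    by (cases c) (simp add: cover_waste_def cover_overlap_def D sum_subtractf sum_distrib_left)
  have markov: "measure \<nu> {c \<in> space \<nu>. u \<le> 2 * ?S c - D} \<le> (L - D) / u" if "0 < u" for u
  proof -
    have "measure \<nu> {c \<in> space \<nu>. u \<le> 2 * ?S c - D} \<le> (\<integral>x. 2 * ?S x - D \<partial>\<nu>) / u"
      using int_excess D_le that
      by (intro integral_Markov_inequality_measure[where A = "{}"] AE_I2) (simp_all only: diff_ge_0_iff_ge sets.empty_sets)
    also have "\<dots> \<le> (L - D) / u"
      unfolding excess using I_nonneg that by (simp add: divide_right_mono)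
    finally show ?thesis .
  qed
  show ?thesis
    unfolding Let_def telescope
    using moments(1-3) I_nonneg I_upper tail paths int_excess excess markov
    by (intro conjI allI impI ballI) simp_all
qed

end
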